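(* Let $p_1,\dots,p_m$ be distinct primes with $p_i\equiv 1\pmod 8$ for all $1\le i\le m$, and let $d=p_1p_2\cdots p_m$. Then: (1) If there exist two integers $r,s\equiv\pm3\pmod 8$ such that $2d=r^2+s^2$, then the equation $x^2-2dy^2=-1$ has no solution $(x,y)\in\mathbb{Z}^2$. (2) If the equation $x^2-2dy^2=-2$ has a solution $(x,y)\in\mathbb{Z}^2$, then $\left(\frac{2}{d}\right)_4=1$.
   Context: For a prime $p\equiv 1\pmod 8$ (so that $2$ is a square modulo $p$), $\left(\frac{2}{p}\right)_4\in\{\pm1\}$ is $1$ if $2$ is a fourth power modulo $p$ and $-1$ otherwise. For $d=p_1\cdots p_m$ with distinct primes $p_i\equiv1\pmod 8$, $\left(\frac{2}{d}\right)_4=\prod_{i=1}^m\left(\frac{2}{p_i}\right)_4$. *)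

theory Defs
  imports "HOL-Number_Theory.Number_Theory"
begin

text \<open>The symbol \<open>(2/p)\<^sub>4\<close>. It is only meant for primes congruent to 1 modulo 8.\<close>

definition quartic_symbol_2 :: "nat \<Rightarrow> int" where
  "quartic_symbol_2 p = (if \<exists>x::int. [x ^ 4 = 2] (mod int p) then 1 else -1)"

text \<open>
  The symbol \<open>(2/d)\<^sub>4\<close>. It is only meant for squarefree \<open>d\<close> all of whose prime factors are
  congruent to 1 modulo 8, so the product runs over the set of prime factors, without
  multiplicities.
\<close>

definition quartic_symbol_2_prod :: "nat \<Rightarrow> int" where
  "quartic_symbol_2_prod d = (\<Prod>p\<in>prime_factors d. quartic_symbol_2 p)"

end

theory Submission
  imports Defs
begin

text \<open>
  For the first claim, suppose that \<open>x\<^sup>2 + 1 = 2 d y\<^sup>2\<close> and \<open>2 d = r\<^sup>2 + s\<^sup>2\<close>. Then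
  \<open>x \<equiv> \<plusminus>1 (mod 8)\<close>. In the Gaussian integers, dividing \<open>(x + i)(r - i s)\<close> by 2 gives
  numbers \<open>Q = (x r + s) / 2\<close> and \<open>P = (r - x s) / 2\<close> with \<open>P\<^sup>2 + Q\<^sup>2 = (d y)\<^sup>2\<close>. The sum of the
  legs of a primitive Pythagorean triple has only prime divisors congruent to \<open>\<plusminus>1\<close> modulo 8,
  since \<open>(P + Q)\<^sup>2 + (P - Q)\<^sup>2\<close> is twice a square. The triple here need not be primitive, but a
  common divisor of the legs divides \<open>2 d\<close>, and the prime divisors of \<open>d\<close> are congruent to 1
  modulo 8. So \<open>S = P + Q\<close> is congruent to \<open>\<plusminus>1\<close> modulo 8 in every case. On the other hand
  \<open>2 S = r (x + 1) + s (1 - x)\<close>, so that \<open>S\<close> is congruent modulo 8 to \<open>r\<close> if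
  \<open>x \<equiv> 1 (mod 8)\<close> and to \<open>s\<close> if \<open>x \<equiv> -1 (mod 8)\<close>. Hence \<open>r\<close> and \<open>s\<close> cannot both be
  congruent to \<open>\<plusminus>3\<close>. This is \<open>two_squares_mod_8\<close>.

  For the second claim, a solution has the form \<open>x = 2 z\<close> with \<open>d y\<^sup>2 = 2 z\<^sup>2 + 1\<close>. Modulo a
  prime \<open>p\<close> dividing \<open>d\<close> this says that \<open>2 z\<^sup>2\<close> is congruent to \<open>-1\<close>, a fourth power, so
  the quartic symbol of 2 at \<open>p\<close> is the Legendre symbol of \<open>z\<close> at \<open>p\<close>
  (\<open>quartic_symbol_2_eq_Legendre\<close>). The product of these over \<open>p\<close> is the Jacobi symbol of \<open>z\<close>
  at \<open>d\<close>. By reciprocity it is computed from the symbols of \<open>d\<close> at the odd primes dividing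
  \<open>z\<close> (\<open>prod_Legendre_eq_1\<close>), and those are 1 because \<open>d y\<^sup>2\<close> is congruent to 1 modulo \<open>z\<close>.
\<close>

section \<open>The quadratic character of 2\<close>

text \<open>
  By Gauss' lemma the symbol counts the doubles of \<open>1, \<dots>, h = (p - 1) / 2\<close> that exceed \<open>h\<close>.
  All doubles are below \<open>p\<close>, so no reduction takes place and the count is \<open>h - h div 2\<close>.
\<close>

lemma Legendre_2:
  fixes p :: nat
  assumes "prime p" "2 < p"
  shows "Legendre 2 (int p) = (if p mod 8 = 1 \<or> p mod 8 = 7 then 1 else -1)"
proof -
  have "odd p"
    using assms prime_odd_nat by blast
  interpret GAUSS p 2
    using assms by unfold_locales (auto simp: cong_def)
  define h where "h = (int p - 1) div 2"
  have h: "int p = 2 * h + 1"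
    using \<open>odd p\<close> by (auto simp: h_def elim: oddE)
  have C: "C = (\<lambda>x. x * 2) ` {0<..h}"
    unfolding C_def B_def A_def h_def[symmetric] image_image
    by (intro image_cong refl mod_pos_pos_trivial) (auto simp: h)
  have "E = (\<lambda>x. x * 2) ` {h div 2<..h}"
    unfolding E_def C h_def[symmetric] using h assms by (auto simp: image_iff)
  then have card_E: "card E = nat (h - h div 2)"
    by (simp add: card_image inj_on_def)
  have "even (nat (h - h div 2)) \<longleftrightarrow> even (h - h div 2)"
    using assms h by (auto simp: even_nat_iff)
  also have "\<dots> \<longleftrightarrow> (2 * h + 1) mod 8 = 1 \<or> (2 * h + 1) mod 8 = 7"
    by presburger
  also have "\<dots> \<longleftrightarrow> p mod 8 = 1 \<or> p mod 8 = 7"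
    unfolding h[symmetric] by (auto simp: zmod_int[of p 8, simplified, symmetric])
  finally show ?thesis
    unfolding gauss_lemma card_E by simp
qed

section \<open>Multiplicativity of the Legendre symbol\<close>

lemma Legendre_values: "Legendre a p \<in> {-1, 0, 1}"
  by (simp add: Legendre_def)

lemma Legendre_eq_1:
  assumes "[c ^ 2 = a] (mod p)" "\<not> p dvd a"
  shows "Legendre a p = 1"
  using assms by (auto simp: Legendre_def QuadRes_def cong_0_iff)

text \<open>
  Euler's criterion gives the identity modulo \<open>p\<close>; both sides have absolute value at most 1,
  and \<open>p > 2\<close>, so they agree.
\<close>

lemma Legendre_mult:
  fixes p :: nat
  assumes "prime p" "2 < p"
  shows "Legendre (a * b) p = Legendre a p * Legendre b p"
proof -
  have "[Legendre (a * b) p = (a * b) ^ ((p - 1) div 2)] (mod p)"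
    by (rule euler_criterion[OF assms])
  moreover have "[Legendre a p * Legendre b p = a ^ ((p - 1) div 2) * b ^ ((p - 1) div 2)] (mod p)"
    by (intro cong_mult euler_criterion assms)
  ultimately have "[Legendre (a * b) p = Legendre a p * Legendre b p] (mod p)"
    by (metis power_mult_distrib cong_trans cong_sym)
  then have dvd: "int p dvd Legendre (a * b) p - Legendre a p * Legendre b p"
    by (simp add: cong_iff_dvd_diff)
  have "\<bar>Legendre (a * b) p - Legendre a p * Legendre b p\<bar> \<le> 2"
    using Legendre_values[of "a * b" p] Legendre_values[of a p] Legendre_values[of b p] by auto
  with dvd show ?thesis
    using assms(2) zdvd_imp_le[of "int p" "\<bar>Legendre (a * b) p - Legendre a p * Legendre b p\<bar>"]
    by (cases "Legendre (a * b) p - Legendre a p * Legendre b p = 0") auto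
qed

lemma Legendre_prod:
  fixes p :: nat
  assumes "prime p" "2 < p"
  shows "Legendre (\<Prod>i\<in>A. f i) p = (\<Prod>i\<in>A. Legendre (f i) p)"
proof -
  have "Legendre 1 (int p) = 1"
    using assms by (intro Legendre_eq_1[of 1]) auto
  then show ?thesis
    by (induction A rule: infinite_finite_induct) (simp_all add: Legendre_mult[OF assms])
qed

text \<open>
  This is Jacobi reciprocity for the modulus \<open>\<Prod>P\<close>, in the only case needed. Splitting off the
  primes \<open>q\<close> of \<open>z\<close> one at a time, it suffices that the product of the symbols of \<open>q\<close> is 1.
  For \<open>q = 2\<close> every factor is 1. For odd \<open>q\<close> each factor may be inverted because
  \<open>p \<equiv> 1 (mod 4)\<close>, and the inverted factors multiply to the symbol of \<open>\<Prod>P\<close> at \<open>q\<close>.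
\<close>

lemma prod_Legendre_eq_1:
  fixes P :: "nat set" and z :: nat
  assumes "finite P" and P: "\<And>p. p \<in> P \<Longrightarrow> prime p \<and> [p = 1] (mod 8)"
    and "z \<noteq> 0"
    and "\<And>q. prime q \<Longrightarrow> q dvd z \<Longrightarrow> q \<notin> P"
    and "\<And>q. prime q \<Longrightarrow> q dvd z \<Longrightarrow> QuadRes q (int (\<Prod>P))"
  shows "(\<Prod>p\<in>P. Legendre z p) = 1"
  using assms(3-)
proof (induction z rule: prime_divisors_induct)
  case zero
  then show ?case by simp
next
  case (unit z)
  have "Legendre 1 (int p) = 1" if "p \<in> P" for p
    using P[OF that] by (intro Legendre_eq_1[of 1]) auto
  with unit show ?case by simp
next
  case (factor q z)
  have big: "2 < p" if "p \<in> P" for p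
    using P[OF that] prime_gt_1_nat[of p] by (cases "p = 2") (auto simp: cong_def)
  have "(\<Prod>p\<in>P. Legendre q p) = 1"
  proof (cases "q = 2")
    case True
    then show ?thesis
      using P big by (intro prod.neutral ballI) (auto simp: Legendre_2 cong_def)
  next
    case False
    then have q: "prime q" "2 < q"
      using factor.hyps prime_gt_1_nat[of q] by auto
    have notin: "q \<notin> P"
      using factor.prems(2) factor.hyps by auto
    have "Legendre q p = Legendre p q" if "p \<in> P" for p
    proof -
      have "even ((p - 1) div 2)"
        using conjunct2[OF P[OF that]] unfolding cong_def by presburger
      then have "Legendre p q * Legendre q p = 1"
        using Quadratic_Reciprocity[of p q] P[OF that] big[OF that] q that notin
        by (auto simp: uminus_power_if)
      then show ?thesis
        using Legendre_values[of p q] Legendre_values[of q p] by auto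
    qed
    then have "(\<Prod>p\<in>P. Legendre q p) = (\<Prod>p\<in>P. Legendre p q)"
      by simp
    also have "\<dots> = Legendre (\<Prod>P) q"
      using Legendre_prod[OF q, of "int" P] by simp
    also have "\<dots> = 1"
    proof -
      have "\<not> q dvd \<Prod>P"
        using q notin P \<open>finite P\<close> by (metis prime_dvd_prod_iff primes_dvd_imp_eq)
      moreover have "QuadRes q (int (\<Prod>P))"
        using factor.prems(3)[of q] factor.hyps by simp
      ultimately show ?thesis
        by (auto simp: QuadRes_def Legendre_def cong_0_iff simp del: of_nat_prod)
    qed
    finally show ?thesis .
  qed
  moreover have "(\<Prod>p\<in>P. Legendre z p) = 1"
    using factor by auto
  moreover have "(\<Prod>p\<in>P. Legendre (int (q * z)) p) = (\<Prod>p\<in>P. Legendre q p * Legendre z p)"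
    using P big by (intro prod.cong refl) (simp add: Legendre_mult)
  ultimately show ?case
    by (simp add: prod.distrib)
qed

section \<open>The quartic symbol\<close>

text \<open>
  If \<open>g\<close> is a primitive root, then \<open>g\<close> to the power \<open>(p - 1) / 2\<close> is \<open>-1\<close>, and 4 divides
  this exponent.
\<close>

lemma minus_one_fourth_power:
  fixes p :: nat
  assumes "prime p" "[p = 1] (mod 8)"
  obtains w :: int where "[w ^ 4 = -1] (mod p)"
proof -
  have p: "2 < p"
    using assms prime_gt_1_nat[of p] by (cases "p = 2") (auto simp: cong_def)
  obtain g where g: "residue_primroot p g"
    using prime_primitive_root_exists[of p] assms(1) p by auto
  define k where "k = (p - 1) div 8"
  have "p mod 8 = 1"
    using assms(2) by (simp add: cong_def)
  then have k: "p - 1 = 8 * k" "0 < k"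
    using p unfolding k_def by presburger+
  have g8: "[g ^ (8 * k) = 1] (mod p)"
    using g assms(1) by (metis ord residue_primroot_def totient_prime k(1))
  have g4: "\<not> [g ^ (4 * k) = 1] (mod p)"
  proof
    assume "[g ^ (4 * k) = 1] (mod p)"
    then have "p - 1 dvd 4 * k"
      using g assms(1) by (metis ord_divides residue_primroot_def totient_prime)
    with k show False
      by (auto dest: dvd_imp_le)
  qed
  define w where "w = int g ^ k"
  have "int p dvd (w ^ 4 - 1) * (w ^ 4 + 1)"
  proof -
    have "[w ^ 8 = 1] (mod int p)"
      using g8 by (simp add: w_def flip: power_mult cong_int_iff) (simp add: mult.commute)
    moreover have "w ^ 8 - 1 = (w ^ 4 - 1) * (w ^ 4 + 1)"
      by (simp add: eval_nat_numeral algebra_simps)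
    ultimately show ?thesis
      by (simp add: cong_iff_dvd_diff)
  qed
  moreover have "\<not> [w ^ 4 = 1] (mod int p)"
    using g4 by (simp add: w_def flip: power_mult cong_int_iff) (simp add: mult.commute)
  ultimately have "[w ^ 4 = -1] (mod int p)"
    using assms(1) by (simp add: prime_dvd_mult_iff cong_iff_dvd_diff)
  then show ?thesis by (rule that)
qed

text \<open>
  With \<open>-1 \<equiv> w\<^sup>4\<close> the hypothesis becomes \<open>2 z\<^sup>2 \<equiv> w\<^sup>4\<close>. So a square root \<open>c\<close> of \<open>z\<close> yields the
  fourth root \<open>w / c\<close> of 2, and a fourth root \<open>x\<close> of 2 yields \<open>z \<equiv> \<plusminus>(w / x)\<^sup>2\<close>, where the sign
  is itself a square.
\<close>

lemma quartic_symbol_2_eq_Legendre: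
  fixes p :: nat and z :: int
  assumes "prime p" "[p = 1] (mod 8)" and z: "[2 * z ^ 2 = -1] (mod p)"
  shows "quartic_symbol_2 p = Legendre z p"
proof -
  have pz: "\<not> int p dvd z"
  proof
    assume "int p dvd z"
    then have "int p dvd 2 * z ^ 2" by (simp add: power2_eq_square)
    with z have "int p dvd 1"
      by (metis cong_dvd_iff dvd_minus_iff)
    with assms(1) show False
      by (simp add: not_prime_unit)
  qed
  have p2: "2 < p"
    using assms prime_gt_1_nat[of p] by (cases "p = 2") (auto simp: cong_def)
  have pp: "prime (int p)"
    using assms by simp
  obtain w where w: "[w ^ 4 = -1] (mod int p)"
    using minus_one_fourth_power[OF assms(1,2)] .
  have zw: "[2 * z ^ 2 = w ^ 4] (mod int p)"
    using z w cong_sym cong_trans by blast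
  have "(\<exists>x::int. [x ^ 4 = 2] (mod int p)) \<longleftrightarrow> QuadRes p z"
  proof
    assume "\<exists>x::int. [x ^ 4 = 2] (mod int p)"
    then obtain x where x: "[x ^ 4 = 2] (mod int p)" by blast
    have "\<not> int p dvd x"
    proof
      assume "int p dvd x"
      then have "int p dvd x ^ 4" by (simp add: numeral_eq_Suc)
      then have "int p dvd 2" using x cong_dvd_iff by blast
      then show False using p2 by (auto dest: zdvd_imp_le)
    qed
    then obtain v where v: "[x * v = 1] (mod int p)"
      using pp by (metis cong_solve_coprime_int coprime_commute prime_imp_coprime)
    have "int p dvd (x ^ 2 * z - w ^ 2) * (x ^ 2 * z + w ^ 2)"
    proof -
      have "[x ^ 4 * z ^ 2 = 2 * z ^ 2] (mod int p)"
        using x by (rule cong_scalar_right)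
      then have "[x ^ 4 * z ^ 2 = w ^ 4] (mod int p)"
        using zw cong_trans by blast
      moreover have "x ^ 4 * z ^ 2 - w ^ 4 = (x ^ 2 * z - w ^ 2) * (x ^ 2 * z + w ^ 2)"
        by (simp add: eval_nat_numeral algebra_simps)
      ultimately show ?thesis
        by (simp add: cong_iff_dvd_diff)
    qed
    then consider "[x ^ 2 * z = w ^ 2] (mod int p)" | "[x ^ 2 * z = - (w ^ 2)] (mod int p)"
      using pp by (auto simp: prime_dvd_mult_iff cong_iff_dvd_diff)
    then obtain u where u: "[x ^ 2 * z = u ^ 2] (mod int p)"
    proof cases
      case 1
      then show ?thesis using that by blast
    next
      case 2
      \<comment> \<open>The sign is absorbed by the square root \<open>w\<^sup>2\<close> of \<open>-1\<close>, so \<open>u = w\<^sup>3\<close> works.\<close>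
      have "[w ^ 4 * w ^ 2 = - 1 * w ^ 2] (mod int p)"
        by (rule cong_scalar_right[OF w])
      with 2 have "[x ^ 2 * z = w ^ 4 * w ^ 2] (mod int p)"
        by (metis cong_sym cong_trans mult_minus1)
      then show ?thesis
        using that[of "w ^ 3"] by (simp add: power_mult[symmetric] power_add[symmetric])
    qed
    have "[(v * u) ^ 2 = z] (mod int p)"
    proof -
      have "[v ^ 2 * u ^ 2 = v ^ 2 * (x ^ 2 * z)] (mod int p)"
        using u cong_scalar_left cong_sym by blast
      moreover have "[(x * v) ^ 2 * z = 1 ^ 2 * z] (mod int p)"
        using v by (intro cong_scalar_right cong_pow)
      ultimately show ?thesis
        by (auto simp: power_mult_distrib ac_simps intro: cong_trans)
    qed
    then show "QuadRes p z"
      by (auto simp: QuadRes_def)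
  next
    assume "QuadRes p z"
    then obtain c where c: "[c ^ 2 = z] (mod int p)"
      by (auto simp: QuadRes_def)
    then have "\<not> int p dvd c"
      using pz by (metis cong_dvd_iff dvd_power zero_less_numeral dvd_trans)
    then obtain v where v: "[c * v = 1] (mod int p)"
      using pp by (metis cong_solve_coprime_int coprime_commute prime_imp_coprime)
    have "[2 * (c ^ 2) ^ 2 = 2 * z ^ 2] (mod int p)"
      using c by (intro cong_scalar_left cong_pow)
    then have "[v ^ 4 * (2 * (c ^ 2) ^ 2) = v ^ 4 * w ^ 4] (mod int p)"
      using zw cong_trans cong_scalar_left by blast
    moreover have "[2 * (c * v) ^ 4 = 2 * 1 ^ 4] (mod int p)"
      using v by (intro cong_scalar_left cong_pow)
    moreover have "v ^ 4 * (2 * (c ^ 2) ^ 2) = 2 * (c * v) ^ 4"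
      by (simp add: eval_nat_numeral algebra_simps)
    ultimately have "[(v * w) ^ 4 = 2] (mod int p)"
      by (metis cong_sym cong_trans mult.right_neutral power_mult_distrib power_one)
    then show "\<exists>x::int. [x ^ 4 = 2] (mod int p)"
      by blast
  qed
  then show ?thesis
    using pz by (simp add: quartic_symbol_2_def Legendre_def cong_0_iff)
qed

lemma quartic_symbol_product:
  fixes P :: "nat set" and x y :: int
  assumes "finite P" and P: "\<And>p. p \<in> P \<Longrightarrow> prime p \<and> [p = 1] (mod 8)"
    and xy: "x\<^sup>2 - 2 * int (\<Prod>P) * y\<^sup>2 = -2"
  shows "(\<Prod>p\<in>P. quartic_symbol_2 p) = 1"
proof -
  define d where "d = int (\<Prod>P)"
  have "x\<^sup>2 = 2 * (d * y\<^sup>2 - 1)"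
    using xy by (simp add: d_def[symmetric] del: of_nat_prod)
  then have "even (x\<^sup>2)" by simp
  then obtain z where xz: "x = 2 * z" by auto
  have "2 * (d * y\<^sup>2) = 2 * (2 * z\<^sup>2 + 1)"
    using xy by (simp add: xz d_def[symmetric] power_mult_distrib del: of_nat_prod)
  then have z: "d * y\<^sup>2 = 2 * z\<^sup>2 + 1" by simp
  have dvd: "int p dvd d" if "p \<in> P" for p
    unfolding d_def using that \<open>finite P\<close> by (simp add: dvd_prod_eqI del: of_nat_prod)
  \<comment> \<open>Zero has no prime factorization to which reciprocity could be applied.\<close>
  show ?thesis
  proof (cases "z = 0")
    case True
    then have "d * y\<^sup>2 = 1"
      using z by simp
    then have "d dvd 1"
      by (metis dvd_triv_left)
    then have "P = {}"
      using dvd P by (metis dvd_trans all_not_in_conv not_prime_unit prime_nat_int_transfer)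
    then show ?thesis by simp
  next
    case False
    have "(\<Prod>p\<in>P. quartic_symbol_2 p) = (\<Prod>p\<in>P. Legendre (int (nat \<bar>z\<bar>)) p)"
    proof (intro prod.cong refl quartic_symbol_2_eq_Legendre)
      fix p assume p: "p \<in> P"
      then show "prime p" "[p = 1] (mod 8)"
        using P by auto
      have "int p dvd 2 * z\<^sup>2 + 1"
        using dvd[OF p] z by (metis dvd_mult2)
      then show "[2 * (int (nat \<bar>z\<bar>))\<^sup>2 = -1] (mod int p)"
        by (simp add: cong_iff_dvd_diff)
    qed
    also have "\<dots> = 1"
    proof (rule prod_Legendre_eq_1[OF \<open>finite P\<close> P])
      show "nat \<bar>z\<bar> \<noteq> 0"
        using False by simp
      fix q :: nat assume q: "prime q" "q dvd nat \<bar>z\<bar>"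
      then have qz: "int q dvd z"
        by (simp add: dvd_nat_abs_iff)
      show "q \<notin> P"
      proof
        assume "q \<in> P"
        then have "int q dvd 2 * z\<^sup>2 + 1"
          using dvd z by (metis dvd_mult2)
        moreover have "int q dvd 2 * z\<^sup>2"
          using qz by (simp add: power2_eq_square)
        ultimately have "int q dvd 1"
          by (simp add: dvd_add_right_iff)
        then show False
          using q by (simp add: not_prime_unit)
      qed
      \<comment> \<open>As \<open>d y\<^sup>2 \<equiv> 1\<close> modulo \<open>q\<close>, the number \<open>d y\<close> is a square root of \<open>d\<close>.\<close>
      have "(d * y)\<^sup>2 - d = d * (d * y\<^sup>2 - 1)"
        by (simp add: power2_eq_square algebra_simps)
      also have "\<dots> = z * (2 * d * z)"
        unfolding z by (simp add: power2_eq_square)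
      finally have "[(d * y)\<^sup>2 = d] (mod q)"
        using qz by (simp add: cong_iff_dvd_diff)
      then show "QuadRes (int q) (int (\<Prod>P))"
        unfolding QuadRes_def d_def by blast
    qed auto
    finally show ?thesis .
  qed
qed

section \<open>Representations as a sum of two squares modulo 8\<close>

lemma mod_8_of_prime_divisors:
  fixes n :: nat
  assumes "\<And>q. prime q \<Longrightarrow> q dvd n \<Longrightarrow> q mod 8 = 1 \<or> q mod 8 = 7" "n \<noteq> 0"
  shows "n mod 8 = 1 \<or> n mod 8 = 7"
  using assms
proof (induction n rule: prime_divisors_induct)
  case (factor q n)
  have "q mod 8 = 1 \<or> q mod 8 = 7"
    by (rule factor.prems(1)) (use factor.hyps in simp_all)
  moreover have "n mod 8 = 1 \<or> n mod 8 = 7"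
    by (rule factor.IH, rule factor.prems(1)) (use factor.prems(2) in simp_all)
  ultimately show ?case
    unfolding mod_mult_eq[of q 8 n, symmetric] by (elim disjE) simp_all
qed auto

lemma square_mod_16:
  fixes x :: int
  assumes "odd x"
  shows "x\<^sup>2 mod 16 = (if x mod 8 = 1 \<or> x mod 8 = 7 then 1 else 9)"
proof -
  define k where "k = x div 8"
  have x: "x = 8 * k + x mod 8" by (simp add: k_def)
  have "x\<^sup>2 = 16 * (4 * k\<^sup>2 + k * (x mod 8)) + (x mod 8)\<^sup>2"
    by (subst x) (simp add: power2_eq_square algebra_simps)
  then have "x\<^sup>2 mod 16 = (x mod 8)\<^sup>2 mod 16" by (simp only: mod_mult_self4)
  moreover have "x mod 8 = 1 \<or> x mod 8 = 3 \<or> x mod 8 = 5 \<or> x mod 8 = 7"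
    using assms by presburger
  ultimately show ?thesis by auto
qed

text \<open>
  The numbers \<open>S\<close> and \<open>T\<close> in the proof are the sum \<open>Q + P\<close> and the difference \<open>Q - P\<close> of the legs
  \<open>Q = (x r + s) / 2\<close> and \<open>P = (r - x s) / 2\<close> of a right triangle with hypotenuse \<open>d y\<close>. The
  residue of \<open>S\<close> modulo 8 is found in two ways: from \<open>x \<equiv> \<plusminus>1 (mod 8)\<close> it is that of \<open>r\<close> or
  \<open>s\<close>, and from the prime divisors of \<open>S\<close> it is \<open>\<plusminus>1\<close>.
\<close>

lemma two_squares_mod_8:
  fixes d r s x y :: int
  assumes d: "[d = 1] (mod 8)" "\<And>q::nat. prime q \<Longrightarrow> int q dvd d \<Longrightarrow> [q = 1] (mod 8)"
    and odd: "odd r" "odd s" and rs: "2 * d = r\<^sup>2 + s\<^sup>2" and xy: "x\<^sup>2 - 2 * d * y\<^sup>2 = -1"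
  shows "\<exists>t\<in>{r, s}. t mod 8 = 1 \<or> t mod 8 = 7"
proof -
  have xy': "x\<^sup>2 + 1 = 2 * (d * y\<^sup>2)" using xy by simp
  have "even (x\<^sup>2 + 1)" unfolding xy' by simp
  then have "odd (x\<^sup>2)" by simp
  then have "odd x" by simp
  have "odd (y\<^sup>2)"
  proof
    assume "even (y\<^sup>2)"
    then have "4 dvd 2 * (d * y\<^sup>2)" by (auto elim!: evenE)
    then show False
      unfolding xy'[symmetric] using square_mod_16[OF \<open>odd x\<close>] by presburger
  qed
  then have "odd y" by simp
  have "[d * y\<^sup>2 = 1] (mod 8)"
  proof -
    have "y\<^sup>2 mod 8 = 1"
      using square_mod_16[OF \<open>odd y\<close>] by presburger
    then show ?thesis
      using cong_mult[OF d(1), of "y\<^sup>2" 1] by (simp add: cong_def)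
  qed
  then have "2 * (d * y\<^sup>2) mod (2 * 8) = 2"
    unfolding mult_mod_right[symmetric] cong_def by simp
  then have "(x\<^sup>2 + 1) mod 16 = 2"
    unfolding xy' by simp
  then have x8: "x mod 8 = 1 \<or> x mod 8 = 7"
    using square_mod_16[OF \<open>odd x\<close>] by presburger
  define S where "S = (r * (x + 1) + s * (1 - x)) div 2"
  define T where "T = (s * (x + 1) - r * (1 - x)) div 2"
  have S: "2 * S = r * (x + 1) + s * (1 - x)" and T: "2 * T = s * (x + 1) - r * (1 - x)"
    using \<open>odd x\<close> by (simp_all add: S_def T_def)
  have S8: "\<exists>t\<in>{r, s}. S mod 8 = t mod 8"
  proof -
    have "even (r - s)" using odd by simp
    then obtain j where j: "r - s = 2 * j" by (rule evenE)
    have "x = 8 * (x div 8) + 1 \<or> x = 8 * (x div 8 + 1) - 1"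
      using x8 by presburger
    then consider k where "x = 8 * k + 1" | k where "x = 8 * k - 1"
      by blast
    then show ?thesis
    proof cases
      case 1
      have "2 * S = 2 * r + 8 * k * (r - s)"
        unfolding S 1 by (simp add: algebra_simps)
      then have "S = r + 8 * (k * j)"
        unfolding j by simp
      then show ?thesis by simp
    next
      case 2
      have "2 * S = 2 * s + 8 * k * (r - s)"
        unfolding S 2 by (simp add: algebra_simps)
      then have "S = s + 8 * (k * j)"
        unfolding j by simp
      then show ?thesis by simp
    qed
  qed
  have ST: "S\<^sup>2 + T\<^sup>2 = 2 * (d * y)\<^sup>2"
  proof -
    have "4 * (S\<^sup>2 + T\<^sup>2) = (2 * S)\<^sup>2 + (2 * T)\<^sup>2" by (simp add: power_mult_distrib)
    also have "\<dots> = 2 * (r\<^sup>2 + s\<^sup>2) * (x\<^sup>2 + 1)" 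
      unfolding S T by (simp add: power2_eq_square algebra_simps)
    also have "\<dots> = 4 * (2 * (d * y)\<^sup>2)" 
      unfolding rs[symmetric] xy' by (simp add: power2_eq_square algebra_simps)
    finally show ?thesis by simp
  qed
  have "odd S"
  proof -
    have "even S \<longleftrightarrow> even (S mod 8)" for S :: int by presburger
    with S8 odd show ?thesis by (metis insert_iff singletonD)
  qed
  have prime_S: "q mod 8 = 1 \<or> q mod 8 = 7" if q: "prime q" "int q dvd S" for q :: nat
  proof (cases "int q dvd d")
    case True
    then show ?thesis using d(2) q by (simp add: cong_def)
  next
    case False
    have pq: "prime (int q)" using q by simp
    have q2: "2 < q"
      using q \<open>odd S\<close> prime_ge_2_nat[of q] by (cases "q = 2") auto
    \<comment> \<open>A prime dividing both \<open>S\<close> and \<open>d y\<close> divides \<open>T\<close> too, hence \<open>2 d\<close>.\<close>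
    have "\<not> int q dvd d * y"
    proof
      assume "int q dvd d * y"
      then have "int q dvd 2 * (d * y)\<^sup>2 - S\<^sup>2"
        using q by (simp add: power2_eq_square)
      then have "int q dvd T\<^sup>2" unfolding ST[symmetric] by simp
      then have "int q dvd T" using pq prime_dvd_power by blast
      have "2 * ((r + s) * S + (s - r) * T) = (r + s) * (2 * S) + (s - r) * (2 * T)"
        by (simp add: algebra_simps)
      also have "\<dots> = 2 * (r\<^sup>2 + s\<^sup>2)"
        unfolding S T by (simp add: power2_eq_square algebra_simps)
      finally have "2 * d = (r + s) * S + (s - r) * T"
        using rs by simp
      then have "int q dvd 2 * d"
        using q(2) \<open>int q dvd T\<close> by simp
      with False pq have "int q dvd 2"
        by (simp add: prime_dvd_mult_iff)
      with q2 show False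
        by (auto dest: zdvd_imp_le)
    qed
    then obtain v where v: "[d * y * v = 1] (mod int q)"
      using pq by (metis cong_solve_coprime_int coprime_commute prime_imp_coprime)
    \<comment> \<open>So \<open>T / (d y)\<close> is a square root of 2 modulo \<open>q\<close>.\<close>
    have "[(T * v)\<^sup>2 = 2] (mod int q)"
    proof -
      have "(T * v)\<^sup>2 - 2 * (d * y * v)\<^sup>2 = (T\<^sup>2 - 2 * (d * y)\<^sup>2) * v\<^sup>2"
        by (simp add: power2_eq_square algebra_simps)
      also have "\<dots> = S * (- S * v\<^sup>2)"
        unfolding ST[symmetric] by (simp add: power2_eq_square)
      finally have "(T * v)\<^sup>2 - 2 * (d * y * v)\<^sup>2 = S * (- S * v\<^sup>2)" .
      then have "[(T * v)\<^sup>2 = 2 * (d * y * v)\<^sup>2] (mod int q)"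
        using q(2) by (simp add: cong_iff_dvd_diff)
      moreover have "[2 * (d * y * v)\<^sup>2 = 2 * 1\<^sup>2] (mod int q)"
        using v by (intro cong_scalar_left cong_pow)
      ultimately show ?thesis
        using cong_trans by fastforce
    qed
    then have "Legendre 2 q = 1"
      using q2 by (intro Legendre_eq_1) (auto dest: zdvd_imp_le)
    then show ?thesis
      using Legendre_2[OF q(1) q2] by (auto split: if_splits)
  qed
  have "nat \<bar>S\<bar> mod 8 = 1 \<or> nat \<bar>S\<bar> mod 8 = 7"
  proof (rule mod_8_of_prime_divisors)
    show "q mod 8 = 1 \<or> q mod 8 = 7" if "prime q" "q dvd nat \<bar>S\<bar>" for q
      using that by (intro prime_S) (simp_all add: dvd_nat_abs_iff)
    show "nat \<bar>S\<bar> \<noteq> 0"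
      using \<open>odd S\<close> by auto
  qed
  moreover have "int (nat \<bar>S\<bar> mod 8) = \<bar>S\<bar> mod 8"
    by (simp add: zmod_int)
  ultimately have "\<bar>S\<bar> mod 8 = 1 \<or> \<bar>S\<bar> mod 8 = 7"
    by linarith
  moreover have "k mod 8 = 1 \<or> k mod 8 = 7" if "(- k) mod 8 = 1 \<or> (- k) mod 8 = 7" for k :: int
    using that by presburger
  ultimately have "S mod 8 = 1 \<or> S mod 8 = 7"
    by (cases "0 \<le> S") (simp_all only: abs_of_nonneg abs_of_neg not_le)
  with S8 show ?thesis by auto
qed

section \<open>Solvability with right-hand sides -1 and -2\<close>

theorem proposition3p4:
  fixes m d :: nat and p :: "nat \<Rightarrow> nat"
  assumes prime_p: "\<And>i. i \<in> {1..m} \<Longrightarrow> prime (p i)"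
    and distinct_p: "inj_on p {1..m}"
    and cong_p: "\<And>i. i \<in> {1..m} \<Longrightarrow> [p i = 1] (mod 8)"
    and d_eq: "d = (\<Prod>i=1..m. p i)"
  shows "((\<exists>r s :: int. ([r = 3] (mod 8) \<or> [r = -3] (mod 8))
                     \<and> ([s = 3] (mod 8) \<or> [s = -3] (mod 8))
                     \<and> 2 * int d = r\<^sup>2 + s\<^sup>2)
          \<longrightarrow> \<not> (\<exists>x y :: int. x\<^sup>2 - 2 * int d * y\<^sup>2 = -1))
       \<and> ((\<exists>x y :: int. x\<^sup>2 - 2 * int d * y\<^sup>2 = -2)
          \<longrightarrow> quartic_symbol_2_prod d = 1)"
proof -
  define P where "P = p ` {1..m}"
  have "finite P"
    by (simp add: P_def)
  have P: "prime q \<and> [q = 1] (mod 8)" if "q \<in> P" for q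
    using that prime_p cong_p by (auto simp: P_def)
  have dP: "d = \<Prod>P"
    unfolding d_eq P_def by (simp only: prod.reindex[OF distinct_p] comp_def)
  have mem_P: "q \<in> P" if "prime q" "q dvd d" for q
    using that P \<open>finite P\<close> unfolding dP by (metis prime_dvd_prod_iff primes_dvd_imp_eq)
  have "d \<noteq> 0"
    unfolding dP using P \<open>finite P\<close> by (metis not_prime_0 prod_zero_iff)
  then have factors: "prime_factors d = P"
    using mem_P P \<open>finite P\<close> by (auto simp: prime_factors_dvd dP intro: dvd_prod_eqI)
  have "[d = (\<Prod>q\<in>P. 1)] (mod 8)"
    unfolding dP using P by (intro cong_prod) auto
  then have d8: "[int d = 1] (mod 8)"
    by (simp add: cong_int_iff[of d 1 8, simplified])
  show ?thesis
  proof (intro conjI impI notI)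
    assume "\<exists>r s :: int. ([r = 3] (mod 8) \<or> [r = -3] (mod 8))
        \<and> ([s = 3] (mod 8) \<or> [s = -3] (mod 8)) \<and> 2 * int d = r\<^sup>2 + s\<^sup>2"
    then obtain r s :: int
      where r: "r mod 8 = 3 \<or> r mod 8 = 5" and s: "s mod 8 = 3 \<or> s mod 8 = 5"
        and rs: "2 * int d = r\<^sup>2 + s\<^sup>2"
      by (auto simp: cong_def)
    assume "\<exists>x y :: int. x\<^sup>2 - 2 * int d * y\<^sup>2 = -1"
    then obtain x y :: int where xy: "x\<^sup>2 - 2 * int d * y\<^sup>2 = -1" by blast
    have "odd r" "odd s"
      using r s by presburger+
    have "\<exists>t\<in>{r, s}. t mod 8 = 1 \<or> t mod 8 = 7"
      using P mem_P by (intro two_squares_mod_8[OF d8 _ \<open>odd r\<close> \<open>odd s\<close> rs xy]) auto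
    with r s show False by auto
  next
    assume "\<exists>x y :: int. x\<^sup>2 - 2 * int d * y\<^sup>2 = -2"
    then obtain x y :: int where "x\<^sup>2 - 2 * int d * y\<^sup>2 = -2" by blast
    then show "quartic_symbol_2_prod d = 1"
      unfolding quartic_symbol_2_prod_def factors
      by (intro quartic_symbol_product[OF \<open>finite P\<close> P]) (simp_all add: dP)
  qed
qed

end
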